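(* Let $k\ge1$, $m\ge1$, and consider the recurrence in ${\bf z}^i=(z_0^i,\dots,z_{k-1}^i)^T\in\mathbb{C}^k$ (with $z_p^i=u_i^{p+1}$) given for $i\ge1$ and $0\le p\le k-1$ by $$z^i_p={}^{0}_{p}C+\sum_{j=1}^{m}\sum_{l_1,\dots,l_j=0}^{k-1}{}^{j}_{p}C_{l_1,\dots,l_j}\prod_{s=1}^{j}z^{i-1}_{l_s},$$ with complex coefficients such that ${}^{j}_{p}C_{l_1,\dots,l_j}=0$ unless $l_1\le\dots\le l_j$. There exists an invertible linear transformation of variables ${\bf z}^i=A{\bf z}'^{i}+B$ (with $A$ a complex $k\times k$ matrix, $\det A\neq0$, and $B\in\mathbb{C}^k$) such that the transition matrix corresponding to the new sequence ${\bf z}'^{i}$ is upper triangular if and only if there exists a $k$-dimensional vector $B=(B_0,\dots,B_{k-1})\in\mathbb{C}^k$ satisfying, for all $0\le p\le k-1$, $$B_p=\sum_{s=0}^{m}\frac{1}{s!}\sum_{l_1,\dots,l_s=0}^{k-1}\sum_{\sigma}{}^{s}_{p}C_{l_{\sigma_1},\dots,l_{\sigma_s}}\prod_{t=1}^{s}B_{l_t},$$ where $\sigma$ runs over all permutations of $\{1,\dots,s\}$.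
   Context: The paper calls the (affine) change of variables ${\bf z}^i=A{\bf z}'^i+B$, $\det A\ne0$, a "linear transformation". The new variables satisfy a recurrence of the same form, ${\bf z}'^{i}=A^{-1}(F(A{\bf z}'^{i-1}+B)-B)$, where $F$ is the polynomial map of the original recurrence; its coefficients, written as ${}^{j}_{p}C'_{l_1,\dots,l_j}$, are again normalized to vanish unless $l_1\le\dots\le l_j$. Transition matrix of a recurrence with coefficients ${}^{j}_{p}C_{l_1,\dots,l_j}$: let ${}^{j}C$ be the $k\times k^j$ matrix with rows indexed by $p$, columns indexed by $(l_1,\dots,l_j)\in\{0,\dots,k-1\}^j$ in lexicographic order, and entries ${}^{j}_{p}C_{l_1,\dots,l_j}$ (${}^0C$ is a column vector; ${}^{j}C=0$ for $j>m$). The transition matrix is the infinite block matrix, with block-row and block-column $\alpha\ge0$ of size $k^\alpha$, whose block-row $0$ is $(1,0,0,\dots)$ and whose block in block-row $\alpha\ge1$, block-column $\beta\ge0$ is $\sum_{j_1+\dots+j_\alpha=\beta}{}^{j_1}C\otimes\dots\otimes{}^{j_\alpha}C$ (sum over integers $j_r\ge0$, $\otimes$ the Kronecker product). Upper triangular means that all entries $T_{ab}$ with $a>b$ (ordinary, not block, indices) vanish. For $s=0$ the term in the equation for $B_p$ is ${}^{0}_{p}C$. *)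

theory Defs
  imports Jordan_Normal_Form.Gauss_Jordan_Elimination Jordan_Normal_Form.Determinant
    "HOL-Combinatorics.Permutations"
begin

text \<open>A coefficient family is a function \<open>C :: nat \<Rightarrow> nat list \<Rightarrow> complex\<close>: the
  coefficient with upper index \<open>j\<close>, row \<open>p\<close> and lower indices \<open>l\<^sub>1, \<dots>, l\<^sub>j\<close> is
  \<open>C p [l\<^sub>1, \<dots>, l\<^sub>j]\<close>, so that \<open>j\<close> is the length of the list.
  Only the values with \<open>p < k\<close>, \<open>j \<le> m\<close> and all \<open>l\<^sub>s < k\<close> are ever inspected.\<close>

definition index_tuples :: "nat \<Rightarrow> nat \<Rightarrow> nat list set" where
  "index_tuples k j = {ls. length ls = j \<and> set ls \<subseteq> {..<k}}"

definition normalized :: "nat \<Rightarrow> nat \<Rightarrow> (nat \<Rightarrow> nat list \<Rightarrow> complex) \<Rightarrow> bool" where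
  "normalized k m C \<longleftrightarrow>
     (\<forall>p<k. \<forall>j\<le>m. \<forall>ls\<in>index_tuples k j. \<not> sorted ls \<longrightarrow> C p ls = 0)"

text \<open>The polynomial map \<open>F\<close> of the recurrence \<open>z\<^sup>i = F z\<^sup>i\<^sup>-\<^sup>1\<close>.\<close>

definition recurrence_map ::
  "nat \<Rightarrow> nat \<Rightarrow> (nat \<Rightarrow> nat list \<Rightarrow> complex) \<Rightarrow> complex vec \<Rightarrow> complex vec" where
  "recurrence_map k m C z = vec k (\<lambda>p. C p [] +
     (\<Sum>j=1..m. \<Sum>ls\<in>index_tuples k j. C p ls * (\<Prod>s<j. z $ (ls ! s))))"

text \<open>\<open>C'\<close> is the coefficient family of the recurrence for \<open>z'\<close>, where \<open>z = A z' + B\<close>.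
  A polynomial map on \<open>\<complex>\<^sup>k\<close> determines its normalized coefficients, so for given \<open>A\<close>, \<open>B\<close>,
  \<open>C\<close> all such \<open>C'\<close> agree on the values that are ever inspected.\<close>

definition transformed_coeffs ::
  "nat \<Rightarrow> nat \<Rightarrow> complex mat \<Rightarrow> complex vec \<Rightarrow>
   (nat \<Rightarrow> nat list \<Rightarrow> complex) \<Rightarrow> (nat \<Rightarrow> nat list \<Rightarrow> complex) \<Rightarrow> bool" where
  "transformed_coeffs k m A B C C' \<longleftrightarrow> normalized k m C' \<and>
     (\<forall>z\<in>carrier_vec k. recurrence_map k m C' z =
        the (mat_inverse A) *\<^sub>v (recurrence_map k m C (A *\<^sub>v z + B) - B))"

text \<open>The \<open>c\<close>-th tuple of length \<open>j\<close> in lexicographic order (counting from 0): its entries are the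
  base-\<open>k\<close> digits of \<open>c\<close>, most significant digit first.\<close>

definition lex_tuple :: "nat \<Rightarrow> nat \<Rightarrow> nat \<Rightarrow> nat list" where
  "lex_tuple k j c = map (\<lambda>s. c div k ^ (j - Suc s) mod k) [0..<j]"

definition coeff_mat ::
  "nat \<Rightarrow> nat \<Rightarrow> (nat \<Rightarrow> nat list \<Rightarrow> complex) \<Rightarrow> nat \<Rightarrow> complex mat" where
  "coeff_mat k m C j =
     (if j \<le> m then mat k (k ^ j) (\<lambda>(p, c). C p (lex_tuple k j c)) else 0\<^sub>m k (k ^ j))"

definition kronecker :: "complex mat \<Rightarrow> complex mat \<Rightarrow> complex mat" where
  "kronecker M N = mat (dim_row M * dim_row N) (dim_col M * dim_col N)
     (\<lambda>(a, b). M $$ (a div dim_row N, b div dim_col N) * N $$ (a mod dim_row N, b mod dim_col N))"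

definition kronecker_list :: "complex mat list \<Rightarrow> complex mat" where
  "kronecker_list Ms = foldr kronecker Ms (1\<^sub>m 1)"

definition transition_block ::
  "nat \<Rightarrow> nat \<Rightarrow> (nat \<Rightarrow> nat list \<Rightarrow> complex) \<Rightarrow> nat \<Rightarrow> nat \<Rightarrow> complex mat" where
  "transition_block k m C \<alpha> \<beta> =
     (if \<alpha> = 0 then (if \<beta> = 0 then 1\<^sub>m 1 else 0\<^sub>m 1 (k ^ \<beta>))
      else mat (k ^ \<alpha>) (k ^ \<beta>) (\<lambda>(r, c).
        \<Sum>js\<in>{js. length js = \<alpha> \<and> sum_list js = \<beta>}.
          kronecker_list (map (coeff_mat k m C) js) $$ (r, c)))"

text \<open>Block \<open>\<alpha>\<close> occupies the \<open>k ^ \<alpha>\<close> ordinary indices starting at \<open>block_start k \<alpha>\<close>.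
  For \<open>k \<ge> 1\<close>, \<open>block_of k a\<close> is the block containing the ordinary index \<open>a\<close>.\<close>

definition block_start :: "nat \<Rightarrow> nat \<Rightarrow> nat" where
  "block_start k \<alpha> = (\<Sum>i<\<alpha>. k ^ i)"

definition block_of :: "nat \<Rightarrow> nat \<Rightarrow> nat" where
  "block_of k a = (LEAST \<alpha>. a < block_start k (Suc \<alpha>))"

definition transition_matrix ::
  "nat \<Rightarrow> nat \<Rightarrow> (nat \<Rightarrow> nat list \<Rightarrow> complex) \<Rightarrow> nat \<Rightarrow> nat \<Rightarrow> complex" where
  "transition_matrix k m C a b =
     transition_block k m C (block_of k a) (block_of k b) $$
       (a - block_start k (block_of k a), b - block_start k (block_of k b))"

definition inf_upper_triangular :: "(nat \<Rightarrow> nat \<Rightarrow> complex) \<Rightarrow> bool" where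
  "inf_upper_triangular T \<longleftrightarrow> (\<forall>a b. b < a \<longrightarrow> T a b = 0)"

end

theory Submission
  imports Defs Jordan_Normal_Form.Schur_Decomposition
begin

text \<open>The transition matrix is upper triangular exactly when the constant coefficients vanish and
  the matrix of linear coefficients is upper triangular: in a block with \<open>\<beta> < \<alpha>\<close> every summand has
  a Kronecker factor \<open>\<^sup>0C = 0\<close>, and the only other summand of a diagonal block is a Kronecker power
  of \<open>\<^sup>1C\<close>. In the coordinates \<open>z = A z' + B\<close> the constant coefficients are \<open>A\<^sup>-\<^sup>1 (F B - B)\<close>, so
  they vanish iff \<open>B\<close> is a fixed point of \<open>F\<close>; the average over permutations in the equation for
  \<open>B\<close> does not change its right-hand side, which is \<open>F B\<close>. The linear coefficients form
  \<open>A\<^sup>-\<^sup>1 (DF B) A\<close>, which some \<open>A\<close> makes upper triangular by Schur decomposition.\<close>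

section \<open>Polynomial maps\<close>

text \<open>Collects tuples of all lengths, so that the constant term (the tuple \<open>[]\<close>)
  and the terms of positive degree become one sum.\<close>

definition tuples_upto :: "nat \<Rightarrow> nat \<Rightarrow> nat list set" where
  "tuples_upto k n = {ls. set ls \<subseteq> {..<k} \<and> length ls \<le> n}"

definition tuple_monom :: "complex vec \<Rightarrow> nat list \<Rightarrow> complex" where
  "tuple_monom z ls = (\<Prod>i\<leftarrow>ls. z $ i)"

lemma finite_tuples_upto [simp]: "finite (tuples_upto k n)"
  unfolding tuples_upto_def by (rule finite_lists_length_le) simp

lemma finite_index_tuples [simp]: "finite (index_tuples k j)"
proof -
  have "index_tuples k j = {ls. set ls \<subseteq> {..<k} \<and> length ls = j}"
    by (auto simp: index_tuples_def)
  then show ?thesis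
    by (simp add: finite_lists_length_eq)
qed

lemma tuple_monom_Nil [simp]: "tuple_monom z [] = 1"
  and tuple_monom_Cons [simp]: "tuple_monom z (i # ls) = z $ i * tuple_monom z ls"
  by (simp_all add: tuple_monom_def)

lemma tuple_monom_conv_prod: "tuple_monom z ls = (\<Prod>s<length ls. z $ (ls ! s))"
  by (simp add: tuple_monom_def prod.list_conv_set_nth atLeast0LessThan)

lemma tuple_monom_cong_mset: "mset ls = mset ls' \<Longrightarrow> tuple_monom z ls = tuple_monom z ls'"
  unfolding tuple_monom_def by (metis mset_map prod_mset_prod_list)

lemma sum_tuples_upto:
  "(\<Sum>ls\<in>tuples_upto k n. f ls) = (\<Sum>j\<le>n. \<Sum>ls\<in>index_tuples k j. f ls)"
proof -
  have "tuples_upto k n = (\<Union>j\<in>{..n}. index_tuples k j)"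
    by (auto simp: tuples_upto_def index_tuples_def)
  then show ?thesis
    by (simp only:, subst sum.UNION_disjoint)
       (simp_all, auto simp: index_tuples_def)
qed

lemma recurrence_map_index:
  assumes "p < k"
  shows "recurrence_map k m C z $ p = (\<Sum>ls\<in>tuples_upto k m. C p ls * tuple_monom z ls)"
proof -
  have *: "(\<Sum>ls\<in>index_tuples k j. C p ls * tuple_monom z ls)
      = (\<Sum>ls\<in>index_tuples k j. C p ls * (\<Prod>s<j. z $ (ls ! s)))" for j
    by (rule sum.cong) (auto simp: index_tuples_def tuple_monom_conv_prod)
  have "{..m} = insert 0 {1..m}"
    by auto
  moreover have "index_tuples k 0 = {[]}"
    by (auto simp: index_tuples_def)
  ultimately show ?thesis
    using assms by (simp add: recurrence_map_def sum_tuples_upto *)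
qed

lemma recurrence_map_carrier [simp]: "recurrence_map k m C z \<in> carrier_vec k"
  by (simp add: recurrence_map_def)

lemma dim_recurrence_map [simp]: "dim_vec (recurrence_map k m C z) = k"
  by (simp add: recurrence_map_def)

lemma tuple_monom_0:
  assumes "set ls \<subseteq> {..<k}"
  shows "tuple_monom (0\<^sub>v k) ls = (if ls = [] then 1 else 0)"
  using assms by (cases ls) auto

lemma recurrence_map_0:
  assumes "p < k"
  shows "recurrence_map k m C (0\<^sub>v k) $ p = C p []"
proof -
  have "recurrence_map k m C (0\<^sub>v k) $ p
      = (\<Sum>ls\<in>tuples_upto k m. if ls = [] then C p ls else 0)"
    unfolding recurrence_map_index[OF assms]
    by (rule sum.cong) (auto simp: tuples_upto_def tuple_monom_0)
  then show ?thesis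
    by (simp add: sum.delta) (simp add: tuples_upto_def)
qed

section \<open>Polynomial functions of bounded degree with normalized coefficients\<close>

definition normal_poly :: "nat \<Rightarrow> nat \<Rightarrow> (complex vec \<Rightarrow> complex) \<Rightarrow> bool" where
  "normal_poly k n f \<longleftrightarrow> (\<exists>c. (\<forall>ls. \<not> sorted ls \<longrightarrow> c ls = 0) \<and>
     (\<forall>z\<in>carrier_vec k. f z = (\<Sum>ls\<in>tuples_upto k n. c ls * tuple_monom z ls)))"

lemma normal_poly_cong:
  assumes "normal_poly k n f" and "\<And>z. z \<in> carrier_vec k \<Longrightarrow> g z = f z"
  shows "normal_poly k n g"
  using assms by (auto simp: normal_poly_def)

lemma normal_poly_add:
  assumes "normal_poly k n f" and "normal_poly k n g"
  shows "normal_poly k n (\<lambda>z. f z + g z)"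
proof -
  obtain c where c: "\<And>ls. \<not> sorted ls \<Longrightarrow> c ls = 0"
    "\<And>z. z \<in> carrier_vec k \<Longrightarrow> f z = (\<Sum>ls\<in>tuples_upto k n. c ls * tuple_monom z ls)"
    using assms(1) by (auto simp: normal_poly_def)
  obtain d where d: "\<And>ls. \<not> sorted ls \<Longrightarrow> d ls = 0"
    "\<And>z. z \<in> carrier_vec k \<Longrightarrow> g z = (\<Sum>ls\<in>tuples_upto k n. d ls * tuple_monom z ls)"
    using assms(2) by (auto simp: normal_poly_def)
  show ?thesis
    unfolding normal_poly_def
    by (rule exI[of _ "\<lambda>ls. c ls + d ls"]) (auto simp: c d ring_distribs sum.distrib)
qed

lemma normal_poly_cmult:
  assumes "normal_poly k n f"
  shows "normal_poly k n (\<lambda>z. a * f z)"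
proof -
  obtain c where c: "\<And>ls. \<not> sorted ls \<Longrightarrow> c ls = 0"
    "\<And>z. z \<in> carrier_vec k \<Longrightarrow> f z = (\<Sum>ls\<in>tuples_upto k n. c ls * tuple_monom z ls)"
    using assms by (auto simp: normal_poly_def)
  show ?thesis
    unfolding normal_poly_def
    by (rule exI[of _ "\<lambda>ls. a * c ls"]) (auto simp: c sum_distrib_left mult.assoc)
qed

lemma normal_poly_0: "normal_poly k n (\<lambda>z. 0)"
  unfolding normal_poly_def by (rule exI[of _ "\<lambda>ls. 0"]) auto

lemma normal_poly_sum:
  assumes "\<And>x. x \<in> X \<Longrightarrow> normal_poly k n (f x)"
  shows "normal_poly k n (\<lambda>z. \<Sum>x\<in>X. f x z)"
  using assms by (induction X rule: infinite_finite_induct) (auto intro: normal_poly_0 normal_poly_add)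

text \<open>Variables commute, so a monomial may be indexed by the sorted tuple instead. All
  normalization happens here; the closure lemmas below only form linear combinations of possibly
  unsorted monomials.\<close>

lemma normal_poly_tuple_monom:
  assumes "ls \<in> tuples_upto k n"
  shows "normal_poly k n (\<lambda>z. tuple_monom z ls)"
proof -
  have "sort ls \<in> tuples_upto k n"
    using assms by (simp add: tuples_upto_def)
  moreover have "tuple_monom z (sort ls) = tuple_monom z ls" for z
    by (rule tuple_monom_cong_mset) simp
  ultimately show ?thesis
    unfolding normal_poly_def
    by (intro exI[of _ "\<lambda>xs. if xs = sort ls then 1 else 0"])
       (auto simp: if_distrib[of "\<lambda>a. a * b" for b] cong: if_cong)
qed

lemma normal_poly_const: "normal_poly k n (\<lambda>z. a)"
  using normal_poly_cmult[OF normal_poly_tuple_monom[of "[]" k n], of a]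
  by (simp add: tuples_upto_def)

lemma normal_poly_mono:
  assumes "normal_poly k n f" and "n \<le> n'"
  shows "normal_poly k n' f"
proof -
  obtain c where c: "\<And>z. z \<in> carrier_vec k \<Longrightarrow>
      f z = (\<Sum>ls\<in>tuples_upto k n. c ls * tuple_monom z ls)"
    using assms(1) by (auto simp: normal_poly_def)
  \<comment> \<open>\<open>c\<close> may be nonzero on tuples longer than \<open>n\<close>, so it
    need not be a witness for \<open>n'\<close>; the sum is rebuilt from its monomials.\<close>
  have "normal_poly k n' (\<lambda>z. \<Sum>ls\<in>tuples_upto k n. c ls * tuple_monom z ls)"
    using assms(2)
    by (intro normal_poly_sum normal_poly_cmult normal_poly_tuple_monom)
       (auto simp: tuples_upto_def)
  then show ?thesis
    by (rule normal_poly_cong) (rule c)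
qed

text \<open>Multiplying by a coordinate prepends an index to each tuple, which raises the degree by
  one.\<close>

lemma normal_poly_mult_affine:
  assumes "normal_poly k n f"
  shows "normal_poly k (Suc n) (\<lambda>z. (b + (\<Sum>i<k. a i * z $ i)) * f z)"
proof -
  obtain c where c: "\<And>z. z \<in> carrier_vec k \<Longrightarrow>
      f z = (\<Sum>ls\<in>tuples_upto k n. c ls * tuple_monom z ls)"
    using assms by (auto simp: normal_poly_def)
  have "normal_poly k (Suc n) (\<lambda>z. \<Sum>ls\<in>tuples_upto k n. c ls *
      (b * tuple_monom z ls + (\<Sum>i<k. a i * tuple_monom z (i # ls))))"
    by (intro normal_poly_sum normal_poly_cmult normal_poly_add normal_poly_tuple_monom)
       (auto simp: tuples_upto_def)
  then show ?thesis
    by (rule normal_poly_cong)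
       (simp add: c sum_distrib_left sum_distrib_right algebra_simps sum.distrib)
qed

lemma normal_poly_prod_affine:
  "normal_poly k (length ls) (\<lambda>z. \<Prod>l\<leftarrow>ls. b l + (\<Sum>i<k. a l i * z $ i))"
proof (induction ls)
  case Nil
  then show ?case
    by (simp add: normal_poly_const)
next
  case (Cons l ls)
  then show ?case
    using normal_poly_mult_affine[OF Cons.IH, of "b l" "a l"] by simp
qed

section \<open>Affine substitution\<close>

lemma index_affine:
  assumes "A \<in> carrier_mat k k" "B \<in> carrier_vec k" "z \<in> carrier_vec k" "l < k"
  shows "(A *\<^sub>v z + B) $ l = B $ l + (\<Sum>i<k. A $$ (l, i) * z $ i)"
  using assms by (auto simp: scalar_prod_def atLeast0LessThan add.commute)

lemma index_mult_mat_vec_sum: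
  assumes "A \<in> carrier_mat k k" "z \<in> carrier_vec k" "l < k"
  shows "(A *\<^sub>v z) $ l = (\<Sum>i<k. A $$ (l, i) * z $ i)"
  using assms by (auto simp: scalar_prod_def atLeast0LessThan)

text \<open>Each monomial turns into a product of at most \<open>m\<close> affine forms, so the
  degree bound survives the substitution.\<close>

lemma normal_poly_recurrence_affine:
  assumes "A \<in> carrier_mat k k" "B \<in> carrier_vec k" "p < k"
  shows "normal_poly k m (\<lambda>z. recurrence_map k m C (A *\<^sub>v z + B) $ p)"
proof -
  have *: "normal_poly k m (\<lambda>z. tuple_monom (A *\<^sub>v z + B) ls)" if "ls \<in> tuples_upto k m" for ls
  proof -
    have "normal_poly k m (\<lambda>z. \<Prod>l\<leftarrow>ls. B $ l + (\<Sum>i<k. A $$ (l, i) * z $ i))"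
      using that by (intro normal_poly_mono[OF normal_poly_prod_affine]) (simp add: tuples_upto_def)
    moreover have "tuple_monom (A *\<^sub>v z + B) ls = (\<Prod>l\<leftarrow>ls. B $ l + (\<Sum>i<k. A $$ (l, i) * z $ i))"
      if "z \<in> carrier_vec k" for z
      unfolding tuple_monom_def
      using \<open>ls \<in> _\<close> assms that
      by (intro arg_cong[of _ _ prod_list] map_cong refl index_affine) (auto simp: tuples_upto_def)
    ultimately show ?thesis
      by (rule normal_poly_cong)
  qed
  show ?thesis
    unfolding recurrence_map_index[OF \<open>p < k\<close>]
    by (intro normal_poly_sum normal_poly_cmult *)
qed

text \<open>Each coordinate of the new map is a linear combination of constants and coordinates of
  \<open>F (A z + B)\<close>, hence has a normalized expansion of degree at most \<open>m\<close>;
  these are chosen row by row.\<close>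

lemma transformed_coeffs_exists:
  assumes A: "A \<in> carrier_mat k k" and D: "the (mat_inverse A) \<in> carrier_mat k k"
    and B: "B \<in> carrier_vec k"
  shows "\<exists>C'. transformed_coeffs k m A B C C'"
proof -
  define D where "D = the (mat_inverse A)"
  let ?G = "\<lambda>z. D *\<^sub>v (recurrence_map k m C (A *\<^sub>v z + B) - B)"
  \<comment> \<open>The subtraction is written as adding a constant, to fit the closure rules for
    sums.\<close>
  have G: "?G z $ p = (\<Sum>i<k. D $$ (p, i) * (recurrence_map k m C (A *\<^sub>v z + B) $ i + - (B $ i)))"
    if "p < k" for z p
    using that D B
    by (subst index_mult_mat_vec_sum[of _ k]) (auto simp: D_def intro!: sum.cong)
  have "normal_poly k m (\<lambda>z. ?G z $ p)" if "p < k" for p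
    unfolding G[OF that] using A B
    by (intro normal_poly_sum normal_poly_cmult normal_poly_add normal_poly_const
        normal_poly_recurrence_affine) auto
  \<comment> \<open>The guard \<open>p < k\<close> stands under the existential quantifier, so that
    choice yields a total family.\<close>
  then have "\<forall>p. \<exists>c. p < k \<longrightarrow> (\<forall>ls. \<not> sorted ls \<longrightarrow> c ls = 0) \<and>
     (\<forall>z\<in>carrier_vec k. ?G z $ p = (\<Sum>ls\<in>tuples_upto k m. c ls * tuple_monom z ls))"
    by (auto simp: normal_poly_def)
  then obtain C' where C': "\<And>p ls. p < k \<Longrightarrow> \<not> sorted ls \<Longrightarrow> C' p ls = 0"
     "\<And>p z. p < k \<Longrightarrow> z \<in> carrier_vec k \<Longrightarrow>
        ?G z $ p = (\<Sum>ls\<in>tuples_upto k m. C' p ls * tuple_monom z ls)"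
    by metis
  have "recurrence_map k m C' z = ?G z" if "z \<in> carrier_vec k" for z
    using D that by (intro eq_vecI) (simp_all add: D_def[symmetric] recurrence_map_index C'(2)[symmetric] del: index_mult_mat_vec)
  then show ?thesis
    using C'(1) by (auto simp: transformed_coeffs_def normalized_def D_def)
qed

section \<open>The linear part\<close>

text \<open>The Jacobian matrix of the recurrence map at \<open>B\<close>. By the product rule,
  differentiating a monomial by variable \<open>q\<close> gives one term for each position
  \<open>s\<close> carrying \<open>q\<close>, with the factor at \<open>s\<close> dropped.\<close>

definition recurrence_jacobian ::
  "nat \<Rightarrow> nat \<Rightarrow> (nat \<Rightarrow> nat list \<Rightarrow> complex) \<Rightarrow> complex vec \<Rightarrow> complex mat" where
  "recurrence_jacobian k m C B = mat k k (\<lambda>(p, q). \<Sum>ls\<in>tuples_upto k m. C p ls *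
     (\<Sum>s | s < length ls \<and> ls ! s = q. \<Prod>r\<in>{..<length ls} - {s}. B $ (ls ! r)))"

text \<open>Restricting to the line through \<open>B\<close> in direction \<open>v\<close> leaves
  one-variable calculus: the product rule sums over positions, and grouping these by their index
  gives the Jacobian applied to \<open>v\<close>.\<close>

lemma recurrence_map_has_derivative:
  assumes B: "B \<in> carrier_vec k" and v: "v \<in> carrier_vec k" and p: "p < k"
  shows "((\<lambda>t. recurrence_map k m C (t \<cdot>\<^sub>v v + B) $ p)
    has_field_derivative (recurrence_jacobian k m C B *\<^sub>v v) $ p) (at 0)"
proof -
  define R where "R ls s = (\<Prod>r\<in>{..<length ls} - {s}. B $ (ls ! r))" for ls s
  have mon: "((\<lambda>t. tuple_monom (t \<cdot>\<^sub>v v + B) ls) has_field_derivative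
      (\<Sum>s<length ls. v $ (ls ! s) * R ls s)) (at 0)" if "ls \<in> tuples_upto k m" for ls
  proof -
    have lt: "ls ! s < k" if "s < length ls" for s
      using that \<open>ls \<in> _\<close> nth_mem by (fastforce simp: tuples_upto_def)
    \<comment> \<open>The factors \<open>0 * v $ (ls ! r) + B $ (ls ! r)\<close> are the values at
      \<open>t = 0\<close>, in the form the product rule produces.\<close>
    have "((\<lambda>t. \<Prod>s<length ls. t * v $ (ls ! s) + B $ (ls ! s)) has_field_derivative
      (\<Sum>s<length ls. v $ (ls ! s) * (\<Prod>r\<in>{..<length ls} - {s}. 0 * v $ (ls ! r) + B $ (ls ! r)))) (at 0)"
      by (rule has_field_derivative_prod) (auto intro!: derivative_eq_intros)
    moreover have "tuple_monom (t \<cdot>\<^sub>v v + B) ls = (\<Prod>s<length ls. t * v $ (ls ! s) + B $ (ls ! s))" for t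
      using B v lt by (auto simp: tuple_monom_conv_prod intro!: prod.cong)
    ultimately show ?thesis
      by (simp add: R_def)
  qed
  have "((\<lambda>t. \<Sum>ls\<in>tuples_upto k m. C p ls * tuple_monom (t \<cdot>\<^sub>v v + B) ls) has_field_derivative
      (\<Sum>ls\<in>tuples_upto k m. C p ls * (\<Sum>s<length ls. v $ (ls ! s) * R ls s))) (at 0)"
    by (intro DERIV_sum DERIV_cmult mon)
  moreover have "(recurrence_jacobian k m C B *\<^sub>v v) $ p =
      (\<Sum>ls\<in>tuples_upto k m. C p ls * (\<Sum>s<length ls. v $ (ls ! s) * R ls s))"
  proof -
    have inner: "(\<Sum>q<k. (\<Sum>s | s < length ls \<and> ls ! s = q. R ls s) * v $ q)
        = (\<Sum>s<length ls. v $ (ls ! s) * R ls s)" if "ls \<in> tuples_upto k m" for ls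
    proof -
      have im: "(\<lambda>s. ls ! s) ` {..<length ls} \<subseteq> {..<k}"
        using that nth_mem by (fastforce simp: tuples_upto_def)
      have "(\<Sum>s<length ls. v $ (ls ! s) * R ls s)
          = (\<Sum>q<k. \<Sum>s\<in>{s\<in>{..<length ls}. ls ! s = q}. v $ (ls ! s) * R ls s)"
        by (rule sum.group[symmetric]) (use im in auto)
      also have "\<dots> = (\<Sum>q<k. (\<Sum>s | s < length ls \<and> ls ! s = q. R ls s) * v $ q)"
        unfolding sum_distrib_right by (intro sum.cong) auto
      finally show ?thesis ..
    qed
    have "(recurrence_jacobian k m C B *\<^sub>v v) $ p =
        (\<Sum>q<k. (\<Sum>ls\<in>tuples_upto k m. C p ls * (\<Sum>s | s < length ls \<and> ls ! s = q. R ls s)) * v $ q)"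
      using v p by (subst index_mult_mat_vec_sum[of _ k])
        (auto simp: recurrence_jacobian_def R_def)
    also have "\<dots> = (\<Sum>ls\<in>tuples_upto k m. C p ls *
        (\<Sum>q<k. (\<Sum>s | s < length ls \<and> ls ! s = q. R ls s) * v $ q))"
      unfolding sum_distrib_right sum_distrib_left by (subst sum.swap) (simp add: mult.assoc)
    also have "\<dots> = (\<Sum>ls\<in>tuples_upto k m. C p ls * (\<Sum>s<length ls. v $ (ls ! s) * R ls s))"
      by (intro sum.cong refl) (simp add: inner)
    finally show ?thesis .
  qed
  ultimately show ?thesis
    by (simp add: recurrence_map_index[OF p])
qed

text \<open>At the origin any factor remaining after one is dropped is zero, so only tuples of
  length one contribute.\<close>

lemma recurrence_jacobian_0:
  assumes "p < k" "q < k" "m \<ge> 1"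
  shows "recurrence_jacobian k m C (0\<^sub>v k) $$ (p, q) = C p [q]"
proof -
  have "(\<Sum>s | s < length ls \<and> ls ! s = q. \<Prod>r\<in>{..<length ls} - {s}. 0\<^sub>v k $ (ls ! r))
      = (if ls = [q] then 1 else 0 :: complex)" if "ls \<in> tuples_upto k m" for ls
  proof -
    have lt: "ls ! s < k" if "s < length ls" for s
      using that \<open>ls \<in> _\<close> nth_mem by (fastforce simp: tuples_upto_def)
    consider "ls = []" | x where "ls = [x]" | "length ls \<ge> 2"
      by (cases ls; cases "tl ls") auto
    then show ?thesis
    proof cases
      case 2
      have "{s. s < length ls \<and> ls ! s = q} = (if x = q then {0} else {})"
        unfolding 2 by auto
      then show ?thesis
        unfolding 2 by (simp add: lessThan_Suc)
    next
      case 3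
      have "(\<Prod>r\<in>{..<length ls} - {s}. 0\<^sub>v k $ (ls ! r)) = (0 :: complex)" if "s < length ls" for s
      proof (rule prod_zero)
        \<comment> \<open>One of the positions 0 and 1 differs from \<open>s\<close> and therefore
          stays in the product.\<close>
        have "(if s = 0 then 1 else 0) \<in> {..<length ls} - {s}"
          using 3 by auto
        then show "\<exists>r\<in>{..<length ls} - {s}. 0\<^sub>v k $ (ls ! r) = (0 :: complex)"
          using lt by (intro bexI[of _ "if s = 0 then 1 else 0"]) auto
      qed simp
      then have "(\<Sum>s | s < length ls \<and> ls ! s = q. \<Prod>r\<in>{..<length ls} - {s}. 0\<^sub>v k $ (ls ! r))
          = (0 :: complex)"
        by (intro sum.neutral) blast
      moreover have "ls \<noteq> [q]"
        using 3 by auto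
      ultimately show ?thesis
        by simp
    qed auto
  qed
  then have "recurrence_jacobian k m C (0\<^sub>v k) $$ (p, q) =
      (\<Sum>ls\<in>tuples_upto k m. if ls = [q] then C p ls else 0)"
    using assms(1,2) unfolding recurrence_jacobian_def
    by (simp del: sum.delta sum.delta') (rule sum.cong, auto)
  also have "\<dots> = C p [q]"
    using assms by (simp add: sum.delta) (simp add: tuples_upto_def)
  finally show ?thesis .
qed

text \<open>The chain rule at the origin. Both sides of the defining equation of \<open>C'\<close>
  are differentiated along the \<open>q\<close>-th axis and the derivatives compared, so the
  composed polynomial is never expanded.\<close>

lemma linear_transformed_coeffs:
  assumes A: "A \<in> carrier_mat k k" and D: "the (mat_inverse A) \<in> carrier_mat k k"
    and B: "B \<in> carrier_vec k" and C': "transformed_coeffs k m A B C C'"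
    and pq: "p < k" "q < k" and "m \<ge> 1"
  shows "C' p [q] = (the (mat_inverse A) * (recurrence_jacobian k m C B * A)) $$ (p, q)"
proof -
  define D where "D = the (mat_inverse A)"
  have Dc: "D \<in> carrier_mat k k"
    using D by (simp add: D_def)
  define J where "J = recurrence_jacobian k m C B"
  have Jc: "J \<in> carrier_mat k k"
    by (simp add: J_def recurrence_jacobian_def)
  let ?e = "unit_vec k q :: complex vec"
  have Ae: "A *\<^sub>v ?e \<in> carrier_vec k"
    using A by simp
  have "((\<lambda>t. recurrence_map k m C' (t \<cdot>\<^sub>v ?e + 0\<^sub>v k) $ p)
      has_field_derivative (recurrence_jacobian k m C' (0\<^sub>v k) *\<^sub>v ?e) $ p) (at 0)"
    using pq by (intro recurrence_map_has_derivative) auto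
  moreover have "(recurrence_jacobian k m C' (0\<^sub>v k) *\<^sub>v ?e) $ p = C' p [q]"
    using pq \<open>m \<ge> 1\<close> recurrence_jacobian_0[OF pq \<open>m \<ge> 1\<close>, of C']
    by (simp add: recurrence_jacobian_def)
  \<comment> \<open>The change of variables carries the axis through 0 to the line through
    \<open>B\<close> in direction \<open>A *\<^sub>v ?e\<close>, where the derivative of the old map
    is known.\<close>
  moreover have "recurrence_map k m C' (t \<cdot>\<^sub>v ?e + 0\<^sub>v k) $ p
      = (\<Sum>i<k. D $$ (p, i) * (recurrence_map k m C (t \<cdot>\<^sub>v (A *\<^sub>v ?e) + B) $ i - B $ i))" for t
  proof -
    have "recurrence_map k m C' (t \<cdot>\<^sub>v ?e) = D *\<^sub>v (recurrence_map k m C (A *\<^sub>v (t \<cdot>\<^sub>v ?e) + B) - B)"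
      using C' by (simp add: transformed_coeffs_def D_def)
    moreover have "A *\<^sub>v (t \<cdot>\<^sub>v ?e) = t \<cdot>\<^sub>v (A *\<^sub>v ?e)"
      using A by (simp add: mult_mat_vec)
    ultimately show ?thesis
      using pq B Dc by (simp add: index_mult_mat_vec_sum[of _ k] del: index_mult_mat_vec)
  qed
  moreover have "((\<lambda>t. \<Sum>i<k. D $$ (p, i) * (recurrence_map k m C (t \<cdot>\<^sub>v (A *\<^sub>v ?e) + B) $ i - B $ i))
      has_field_derivative (\<Sum>i<k. D $$ (p, i) * ((J *\<^sub>v (A *\<^sub>v ?e)) $ i - 0))) (at 0)"
    unfolding J_def
    by (intro DERIV_sum DERIV_cmult DERIV_diff DERIV_const recurrence_map_has_derivative B Ae) simp
  ultimately have "C' p [q] = (\<Sum>i<k. D $$ (p, i) * (J *\<^sub>v (A *\<^sub>v ?e)) $ i)"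
    by (auto dest: DERIV_unique)
  also have "\<dots> = (D *\<^sub>v (J *\<^sub>v (A *\<^sub>v ?e))) $ p"
    using Dc Jc Ae pq by (subst index_mult_mat_vec_sum[of _ k]) auto
  also have "D *\<^sub>v (J *\<^sub>v (A *\<^sub>v ?e)) = (D * (J * A)) *\<^sub>v ?e"
    using A Dc Jc by (simp add: assoc_mult_mat_vec[of _ k k _ k])
  also have "\<dots> $ p = (D * (J * A)) $$ (p, q)"
  proof -
    define M where "M = D * (J * A)"
    have "M \<in> carrier_mat k k"
      using A Dc Jc by (simp add: M_def)
    with pq have "(M *\<^sub>v unit_vec k q) $ p = M $$ (p, q)"
      by simp
    then show ?thesis
      by (simp add: M_def)
  qed
  finally show ?thesis
    by (simp add: D_def J_def)
qed

section \<open>Triangularity of the transition matrix\<close>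

lemma dim_kronecker [simp]:
  "dim_row (kronecker M N) = dim_row M * dim_row N"
  "dim_col (kronecker M N) = dim_col M * dim_col N"
  by (simp_all add: kronecker_def)

lemma kronecker_list_Nil [simp]: "kronecker_list [] = 1\<^sub>m 1"
  and kronecker_list_Cons [simp]: "kronecker_list (M # Ms) = kronecker M (kronecker_list Ms)"
  by (simp_all add: kronecker_list_def)

lemma index_kronecker:
  assumes "r < dim_row M * dim_row N" "c < dim_col M * dim_col N"
  shows "kronecker M N $$ (r, c) =
    M $$ (r div dim_row N, c div dim_col N) * N $$ (r mod dim_row N, c mod dim_col N)"
  using assms by (simp add: kronecker_def)

lemma div_mod_less_of_less_mult:
  assumes "(r::nat) < a * b"
  shows "r div b < a" "r mod b < b"
proof -
  have "b > 0"
    using assms by (cases b) auto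
  with assms show "r div b < a" "r mod b < b"
    by (simp_all add: less_mult_imp_div_less)
qed

text \<open>An entry of the product multiplies one entry of every factor, and the div-mod bounds
  keep these positions in range, so an entry of the zero factor always occurs.\<close>

lemma kronecker_list_eq_0:
  assumes "0\<^sub>m n1 n2 \<in> set Ms"
    and "r < dim_row (kronecker_list Ms)" "c < dim_col (kronecker_list Ms)"
  shows "kronecker_list Ms $$ (r, c) = 0"
  using assms
proof (induction Ms arbitrary: r c)
  case (Cons M Ms)
  note r = div_mod_less_of_less_mult[of r "dim_row M" "dim_row (kronecker_list Ms)"]
  note c = div_mod_less_of_less_mult[of c "dim_col M" "dim_col (kronecker_list Ms)"]
  show ?case
  proof (cases "M = 0\<^sub>m n1 n2")
    case True
    with Cons.prems r c show ?thesis
      by (simp add: index_kronecker)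
  next
    case False
    with Cons.prems Cons.IH r c show ?thesis
      by (simp add: index_kronecker)
  qed
qed simp

text \<open>For square factors, row and column indices split by the same divisor and compare
  lexicographically by quotient and remainder. Below the diagonal, either the quotients lie below
  the diagonal of \<open>M\<close>, or they agree and the remainders lie below that of
  \<open>N\<close>.\<close>

lemma kronecker_upper_triangular:
  assumes "upper_triangular M" "upper_triangular N" "square_mat M" "square_mat N"
  shows "upper_triangular (kronecker M N)"
proof (rule upper_triangularI)
  fix r c assume cr: "c < r" and r: "r < dim_row (kronecker M N)"
  define n where "n = dim_row N"
  have dims: "dim_col N = n" "dim_col M = dim_row M"
    using assms by (simp_all add: n_def)
  have r': "r div n < dim_row M" "r mod n < n"
    using r div_mod_less_of_less_mult[of r "dim_row M" n] by (simp_all add: n_def)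
  have "c div n \<le> r div n"
    using cr by (simp add: div_le_mono)
  then consider "c div n < r div n" | "c div n = r div n" "c mod n < r mod n"
    using cr by (metis div_mult_mod_eq le_neq_implies_less nat_add_left_cancel_less)
  then have "M $$ (r div n, c div n) = 0 \<or> N $$ (r mod n, c mod n) = 0"
    using assms r' by cases (auto simp: n_def dest: upper_triangularD)
  then show "kronecker M N $$ (r, c) = 0"
    using r cr dims by (auto simp: index_kronecker n_def)
qed

lemma kronecker_list_replicate_upper_triangular:
  assumes "upper_triangular M" "square_mat M"
  shows "upper_triangular (kronecker_list (replicate n M)) \<and>
    square_mat (kronecker_list (replicate n M))"
  using assms by (induction n) (auto intro!: kronecker_upper_triangular)

lemma dim_coeff_mat [simp]:
  "dim_row (coeff_mat k m C j) = k" "dim_col (coeff_mat k m C j) = k ^ j"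
  by (simp_all add: coeff_mat_def)

lemma dim_kronecker_list_coeff_mat [simp]:
  "dim_row (kronecker_list (map (coeff_mat k m C) js)) = k ^ length js"
  "dim_col (kronecker_list (map (coeff_mat k m C) js)) = k ^ sum_list js"
  by (induction js) (simp_all add: power_add)

lemma coeff_mat_0:
  assumes "\<And>p. p < k \<Longrightarrow> C p [] = 0"
  shows "coeff_mat k m C 0 = 0\<^sub>m k 1"
  using assms by (intro eq_matI) (auto simp: coeff_mat_def lex_tuple_def)

lemma coeff_mat_1_upper_triangular:
  assumes "\<And>p q. q < p \<Longrightarrow> p < k \<Longrightarrow> C p [q] = 0" and "m \<ge> 1"
  shows "upper_triangular (coeff_mat k m C 1)"
  using assms by (intro upper_triangularI) (auto simp: coeff_mat_def lex_tuple_def)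

text \<open>Classifies the summands of the blocks on or below the block diagonal: without a 0 every
  entry is at least 1, and the bound on the sum leaves no room for more.\<close>

lemma sum_list_le_length_cases:
  fixes js :: "nat list"
  assumes "sum_list js \<le> length js"
  shows "0 \<in> set js \<or> js = replicate (length js) 1"
proof -
  have ge: "sum_list xs \<ge> length xs" if "0 \<notin> set xs" for xs :: "nat list"
    using that by (induction xs) auto
  show ?thesis
    using assms by (induction js) (auto simp: not_le dest: ge)
qed

section \<open>Ordinary indices and their blocks\<close>

lemma block_start_Suc: "block_start k (Suc \<alpha>) = block_start k \<alpha> + k ^ \<alpha>"
  by (simp add: block_start_def)

lemma le_block_start: "k \<ge> 1 \<Longrightarrow> \<alpha> \<le> block_start k \<alpha>"
proof (induction \<alpha>)
  case (Suc \<alpha>)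
  moreover have "k ^ \<alpha> \<ge> 1"
    using Suc.prems by simp
  ultimately show ?case
    unfolding block_start_Suc by linarith
qed simp

lemma less_block_start_Suc_block_of:
  assumes "k \<ge> 1"
  shows "a < block_start k (Suc (block_of k a))"
  unfolding block_of_def
  \<comment> \<open>Blocks are nonempty, so block \<open>a\<close> ends after index
    \<open>a\<close>; this witness makes the \<open>LEAST\<close> meaningful.\<close>
  by (rule LeastI[of _ a]) (use le_block_start[OF assms, of "Suc a"] in linarith)

lemma block_start_block_of_le: "block_start k (block_of k a) \<le> a"
proof (cases "block_of k a")
  case 0
  then show ?thesis
    by (simp add: block_start_def)
next
  case (Suc \<alpha>)
  then have "\<not> a < block_start k (Suc \<alpha>)"
    unfolding block_of_def by (intro not_less_Least) simp
  with Suc show ?thesis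
    by simp
qed

lemma block_of_mono:
  assumes "k \<ge> 1" "b \<le> a"
  shows "block_of k b \<le> block_of k a"
  unfolding block_of_def[of k b]
  by (rule Least_le) (use less_block_start_Suc_block_of[OF assms(1), of a] assms(2) in linarith)

lemma block_of_eqI:
  assumes "block_start k \<alpha> \<le> a" "a < block_start k (Suc \<alpha>)"
  shows "block_of k a = \<alpha>"
  unfolding block_of_def
proof (rule Least_equality)
  fix \<beta> assume "a < block_start k (Suc \<beta>)"
  with assms have "\<not> block_start k (Suc \<beta>) \<le> block_start k \<alpha>"
    by linarith
  moreover have "block_start k (Suc \<beta>) \<le> block_start k \<alpha>" if "Suc \<beta> \<le> \<alpha>"
    unfolding block_start_def using that by (intro sum_mono2) auto
  ultimately show "\<alpha> \<le> \<beta>"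
    by linarith
qed (rule assms)

text \<open>Ordinary rows 1 to \<open>k\<close> form block row 1, and the sole summand of block (1,
  0) comes from \<open>[0]\<close>. Triangularity thus controls the constant coefficients.\<close>

lemma transition_matrix_first_column:
  assumes "p < k"
  shows "transition_matrix k m C (Suc p) 0 = C p []"
proof -
  have "block_of k (Suc p) = 1" "block_of k 0 = 0"
    using assms by (auto intro!: block_of_eqI simp: block_start_def)
  moreover have "{js :: nat list. length js = Suc 0 \<and> sum_list js = 0} = {[0]}"
    by (auto simp: length_Suc_conv)
  ultimately show ?thesis
    using assms
    by (simp add: transition_matrix_def transition_block_def block_start_def index_kronecker
        coeff_mat_def lex_tuple_def)
qed

lemma transition_matrix_upper_triangular:
  assumes k: "k \<ge> 1" and m: "m \<ge> 1"
    and const: "\<And>p. p < k \<Longrightarrow> C p [] = 0"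
    and lin: "\<And>p q. q < p \<Longrightarrow> p < k \<Longrightarrow> C p [q] = 0"
  shows "inf_upper_triangular (transition_matrix k m C)"
  unfolding inf_upper_triangular_def
proof (intro allI impI)
  fix a b :: nat assume ba: "b < a"
  define \<alpha> \<beta> where "\<alpha> = block_of k a" and "\<beta> = block_of k b"
  define r c where "r = a - block_start k \<alpha>" and "c = b - block_start k \<beta>"
  have r: "r < k ^ \<alpha>" and c: "c < k ^ \<beta>"
    using less_block_start_Suc_block_of[OF k, of a] block_start_block_of_le[of k a]
      less_block_start_Suc_block_of[OF k, of b] block_start_block_of_le[of k b]
    by (simp_all add: r_def c_def \<alpha>_def \<beta>_def block_start_Suc)
  have le: "\<beta> \<le> \<alpha>"
    using block_of_mono[OF k] ba by (simp add: \<alpha>_def \<beta>_def)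
  \<comment> \<open>In a diagonal block both indices have the same offset subtracted, so their order
    persists.\<close>
  have cr: "c < r" if "\<alpha> = \<beta>"
    using that ba block_start_block_of_le[of k b] by (simp add: r_def c_def \<beta>_def)
  have term_0: "kronecker_list (map (coeff_mat k m C) js) $$ (r, c) = 0"
    if js: "length js = \<alpha>" "sum_list js = \<beta>" for js
  proof -
    have "0 \<in> set js \<or> js = replicate \<alpha> 1"
      using sum_list_le_length_cases[of js] js le by simp
    then show ?thesis
    proof
      assume "0 \<in> set js"
      then have "0\<^sub>m k 1 \<in> set (map (coeff_mat k m C) js)"
        using coeff_mat_0[of k C m] const by force
      then show ?thesis
        using r c js by (intro kronecker_list_eq_0) auto
    next
      \<comment> \<open>All entries being 1 forces a diagonal block, where the summand is a
        Kronecker power of an upper triangular matrix and the entry lies below its diagonal.\<close>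
      assume eq: "js = replicate \<alpha> 1"
      then have "\<alpha> = \<beta>"
        using js by (simp add: sum_list_replicate)
      moreover have "upper_triangular (kronecker_list (replicate \<alpha> (coeff_mat k m C 1)))"
        using coeff_mat_1_upper_triangular[of k C m] lin m
        by (intro kronecker_list_replicate_upper_triangular[THEN conjunct1]) auto
      moreover have "r < dim_row (kronecker_list (map (coeff_mat k m C) js))"
        using r js by simp
      ultimately show ?thesis
        using cr eq by (simp add: upper_triangularD)
    qed
  qed
  \<comment> \<open>This excludes the separately defined block row 0: it would give
    \<open>\<beta> = 0\<close> and, as \<open>k ^ 0 = 1\<close>, \<open>r = c = 0\<close>, against
    \<open>cr\<close>.\<close>
  have "\<alpha> \<noteq> 0"
    using r c cr le by (metis le_zero_eq less_one not_less_zero power_0)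
  then have "transition_block k m C \<alpha> \<beta> $$ (r, c) = 0"
    using r c term_0 by (simp add: transition_block_def)
  then show "transition_matrix k m C a b = 0"
    by (simp add: transition_matrix_def \<alpha>_def \<beta>_def r_def c_def)
qed

section \<open>Fixed points\<close>

text \<open>For fixed \<open>\<sigma>\<close>, permuting positions is a bijection on the tuples that
  preserves the monomial. All \<open>fact s\<close> permutations thus give the same sum, and the
  factor \<open>1 / fact s\<close> cancels their number.\<close>

lemma sum_permuted_tuples:
  "1 / fact s * (\<Sum>ls\<in>index_tuples k s. \<Sum>\<sigma> | \<sigma> permutes {..<s}.
      C (permute_list \<sigma> ls) * (\<Prod>t<s. B $ (ls ! t)))
    = (\<Sum>ls\<in>index_tuples k s. C ls * tuple_monom B ls)"
proof -
  have perm: "(\<Sum>ls\<in>index_tuples k s. C (permute_list \<sigma> ls) * (\<Prod>t<s. B $ (ls ! t)))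
      = (\<Sum>ls\<in>index_tuples k s. C ls * tuple_monom B ls)" if \<sigma>: "\<sigma> permutes {..<s}" for \<sigma>
  proof (rule sum.reindex_bij_witness[where j = "permute_list \<sigma>" and i = "permute_list (inv_into UNIV \<sigma>)"])
    fix ls assume ls: "ls \<in> index_tuples k s"
    then have len: "length ls = s"
      by (simp add: index_tuples_def)
    have \<sigma>': "inv_into UNIV \<sigma> permutes {..<s}"
      using \<sigma> by (rule permutes_inv)
    show "permute_list (inv_into UNIV \<sigma>) (permute_list \<sigma> ls) = ls"
      using permute_list_compose[of "inv_into UNIV \<sigma>" ls \<sigma>] \<sigma> \<sigma>' len by (simp add: permutes_inv_o)
    show "permute_list \<sigma> (permute_list (inv_into UNIV \<sigma>) ls) = ls"
      using permute_list_compose[of \<sigma> ls "inv_into UNIV \<sigma>"] \<sigma> \<sigma>' len by (simp add: permutes_inv_o)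
    show "permute_list \<sigma> ls \<in> index_tuples k s" "permute_list (inv_into UNIV \<sigma>) ls \<in> index_tuples k s"
      using ls \<sigma> \<sigma>' by (auto simp: index_tuples_def)
    have "tuple_monom B (permute_list \<sigma> ls) = tuple_monom B ls"
      using \<sigma> len by (intro tuple_monom_cong_mset) simp
    then show "C (permute_list \<sigma> ls) * tuple_monom B (permute_list \<sigma> ls)
        = C (permute_list \<sigma> ls) * (\<Prod>t<s. B $ (ls ! t))"
      using len by (simp add: tuple_monom_conv_prod)
  qed
  have "card {\<sigma>. \<sigma> permutes {..<s}} = fact s"
    by (simp add: card_permutations)
  then show ?thesis
    by (subst sum.swap) (simp add: perm)
qed

lemma recurrence_fixed_point_iff:
  assumes "B \<in> carrier_vec k"
  shows "recurrence_map k m C B = B \<longleftrightarrow>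
    (\<forall>p<k. B $ p = (\<Sum>s=0..m. 1 / fact s *
       (\<Sum>ls\<in>index_tuples k s. \<Sum>\<sigma> | \<sigma> permutes {..<s}.
          C p (permute_list \<sigma> ls) * (\<Prod>t<s. B $ (ls ! t)))))"
proof -
  have "recurrence_map k m C B = B \<longleftrightarrow> (\<forall>p<k. B $ p = recurrence_map k m C B $ p)"
    using assms by (auto simp: vec_eq_iff)
  then show ?thesis
    unfolding sum_permuted_tuples
    by (simp add: recurrence_map_index sum_tuples_upto atMost_atLeast0)
qed

text \<open>Identifies the inverse in \<open>transformed_coeffs\<close> with the one delivered by
  the similarity: a two-sided inverse rules out \<open>None\<close>, and
  \<open>E = E (A D) = (E A) D = D\<close>.\<close>

lemma mat_inverse_unique:
  assumes A: "A \<in> carrier_mat n n" and D: "D \<in> carrier_mat n n" and "D * A = 1\<^sub>m n" "A * D = 1\<^sub>m n"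
  shows "mat_inverse A = Some (D :: 'a :: field mat)"
proof (cases "mat_inverse A")
  case None
  then have "A \<notin> Units (ring_mat TYPE('a) n ())"
    by (rule mat_inverse(1)[OF A])
  with assms show ?thesis
    by (auto simp: Units_def ring_mat_simps)
next
  case (Some E)
  from mat_inverse(2)[OF A this] have E: "E * A = 1\<^sub>m n" "E \<in> carrier_mat n n"
    by auto
  have "E = E * (A * D)"
    using assms E by simp
  also have "\<dots> = (E * A) * D"
    by (rule assoc_mult_mat[symmetric]) (use A D E in auto)
  also have "\<dots> = D"
    using E D by simp
  finally show ?thesis
    using Some by simp
qed

theorem lemma3p2:
  fixes k m :: nat and C :: "nat \<Rightarrow> nat list \<Rightarrow> complex"
  assumes "k \<ge> 1" and "m \<ge> 1" and "normalized k m C"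
  shows "(\<exists>A B C'. A \<in> carrier_mat k k \<and> det A \<noteq> 0 \<and> B \<in> carrier_vec k \<and>
            transformed_coeffs k m A B C C' \<and>
            inf_upper_triangular (transition_matrix k m C')) \<longleftrightarrow>
         (\<exists>B \<in> carrier_vec k. \<forall>p<k.
            B $ p = (\<Sum>s=0..m. 1 / fact s *
              (\<Sum>ls\<in>index_tuples k s. \<Sum>\<sigma> | \<sigma> permutes {..<s}.
                 C p (permute_list \<sigma> ls) * (\<Prod>t<s. B $ (ls ! t)))))"
    (is "?L \<longleftrightarrow> ?R")
proof
  assume ?L
  then obtain A B C' where A: "A \<in> carrier_mat k k" "det A \<noteq> 0" and B: "B \<in> carrier_vec k"
    and C': "transformed_coeffs k m A B C C'"
    and T: "inf_upper_triangular (transition_matrix k m C')"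
    by blast
  obtain D where D: "mat_inverse A = Some D"
    using det_non_zero_imp_unit[OF A, of "()"] mat_inverse(1)[OF A(1), of "()"] by (cases "mat_inverse A") auto
  have AD: "A * D = 1\<^sub>m k" and Dc: "D \<in> carrier_mat k k"
    using mat_inverse(2)[OF A(1) D] by auto
  \<comment> \<open>The entry in row \<open>Suc p\<close> and column 0 lies strictly below the
    diagonal.\<close>
  have "C' p [] = 0" if "p < k" for p
    using T transition_matrix_first_column[OF that, of m C'] by (simp add: inf_upper_triangular_def)
  then have "recurrence_map k m C' (0\<^sub>v k) = 0\<^sub>v k"
    by (intro eq_vecI) (simp_all add: recurrence_map_0)
  moreover have "recurrence_map k m C' (0\<^sub>v k) = D *\<^sub>v (recurrence_map k m C (A *\<^sub>v 0\<^sub>v k + B) - B)"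
    using C' D by (simp add: transformed_coeffs_def)
  moreover have "A *\<^sub>v 0\<^sub>v k + B = B"
    using A B by (intro eq_vecI) auto
  \<comment> \<open>Applying \<open>A\<close> cancels \<open>D\<close>, which turns the vanishing
    constant part into \<open>F B - B = 0\<close>.\<close>
  ultimately have "A *\<^sub>v (D *\<^sub>v (recurrence_map k m C B - B)) = A *\<^sub>v 0\<^sub>v k"
    by simp
  then have "(A * D) *\<^sub>v (recurrence_map k m C B - B) = 0\<^sub>v k"
    using A B Dc by (subst assoc_mult_mat_vec[of _ k k _ k]) auto
  then have diff: "recurrence_map k m C B - B = 0\<^sub>v k"
    using AD B by simp
  have "recurrence_map k m C B = B"
  proof (rule eq_vecI)
    fix i assume "i < dim_vec B"
    with B arg_cong[OF diff, of "\<lambda>v. v $ i"] show "recurrence_map k m C B $ i = B $ i"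
      by simp
  qed (use B in simp)
  with B show ?R
    by (auto simp: recurrence_fixed_point_iff)
next
  assume ?R
  then obtain B where B: "B \<in> carrier_vec k" and fixpoint: "recurrence_map k m C B = B"
    using recurrence_fixed_point_iff by blast
  define J where "J = recurrence_jacobian k m C B"
  have J: "J \<in> carrier_mat k k"
    by (simp add: J_def recurrence_jacobian_def)
  \<comment> \<open>Over the complex numbers the characteristic polynomial splits, as Schur
    decomposition requires.\<close>
  obtain es where "char_poly J = (\<Prod>a\<leftarrow>es. [:- a, 1:])"
    using char_poly_factorized[OF J] by blast
  then obtain U where U: "U \<in> carrier_mat k k" "upper_triangular U" "similar_mat J U"
    using schur_decomposition_exists[OF J] by blast
  \<comment> \<open>The similarity matrix itself serves as the linear part of the change of
    variables.\<close>
  then obtain A D where "similar_mat_wit J U A D"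
    by (auto simp: similar_mat_def)
  from similar_mat_witD2[OF J this] have AD: "A * D = 1\<^sub>m k" "D * A = 1\<^sub>m k" "J = A * U * D"
    and Ac: "A \<in> carrier_mat k k" and Dc: "D \<in> carrier_mat k k"
    by auto
  have inv: "mat_inverse A = Some D"
    using AD Ac Dc by (intro mat_inverse_unique) auto
  have "det A * det D = 1"
    using AD(1) det_mult[OF Ac Dc] by simp
  then have det: "det A \<noteq> 0"
    by auto
  obtain C' where C': "transformed_coeffs k m A B C C'"
    using transformed_coeffs_exists[OF Ac _ B] inv Dc by auto
  have DJA: "D * (J * A) = U"
  proof -
    have "J * A = A * U * (D * A)"
      unfolding AD(3) using Ac Dc U(1) by (intro assoc_mult_mat) auto
    then have "J * A = A * U"
      using AD(2) Ac U(1) by simp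
    moreover have "D * (A * U) = (D * A) * U"
      using Ac Dc U(1) by (intro assoc_mult_mat[symmetric]) auto
    ultimately show ?thesis
      using AD(2) U(1) by simp
  qed
  have "C' p [q] = 0" if "q < p" "p < k" for p q
  proof -
    have "C' p [q] = (the (mat_inverse A) * (recurrence_jacobian k m C B * A)) $$ (p, q)"
      using that inv Dc \<open>m \<ge> 1\<close> by (intro linear_transformed_coeffs[OF Ac _ B C']) auto
    also have "\<dots> = U $$ (p, q)"
      using DJA by (simp only: inv J_def option.sel)
    also have "\<dots> = 0"
      using that U by (intro upper_triangularD) auto
    finally show ?thesis .
  qed
  moreover have "C' p [] = 0" if "p < k" for p
  proof -
    \<comment> \<open>The value at the origin is the constant part; there the new map gives
      \<open>D\<close> applied to \<open>F B - B\<close>, which is zero.\<close>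
    have "recurrence_map k m C' (0\<^sub>v k) = D *\<^sub>v (recurrence_map k m C (A *\<^sub>v 0\<^sub>v k + B) - B)"
      using C' inv by (simp add: transformed_coeffs_def)
    moreover have "A *\<^sub>v 0\<^sub>v k + B = B"
      using Ac B by (intro eq_vecI) auto
    ultimately have "recurrence_map k m C' (0\<^sub>v k) = 0\<^sub>v k"
      using fixpoint B Dc by (auto intro!: eq_vecI)
    then show ?thesis
      using recurrence_map_0[OF that, of m C'] that by simp
  qed
  ultimately have "inf_upper_triangular (transition_matrix k m C')"
    using \<open>k \<ge> 1\<close> \<open>m \<ge> 1\<close> by (intro transition_matrix_upper_triangular) auto
  with Ac det B C' show ?L
    by blast
qed

end
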